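(* If $G$ is a block graph with at least $2$ vertices, then ${\rm gp}(G)\geq {\rm Z}(G)+1$.
   Context: All graphs are finite and simple. A block graph is a connected graph in which every block (maximal $2$-connected subgraph, or bridge) is a clique. Zero forcing: given a set $S\subseteq V(G)$ of initially black vertices (all others white), the color-change rule turns a white vertex $y$ black if $y$ is the only white neighbor of some black vertex $x$. ${\rm Z}(G)$ is the minimum size of a set $S$ such that repeated application of the rule eventually turns all vertices black. A set $R\subseteq V(G)$ is a general position set if no three vertices of $R$ lie on a common shortest path of $G$; ${\rm gp}(G)$ is the maximum size of a general position set of $G$. *)

theory Defs
  imports "Graph_Theory.Graph_Theory"
begin

text \<open>
  Finite simple graphs are the locale \<^locale>\<open>graph\<close> of the AFP entry Graph_Theory: finite symmetric
  loop-free digraphs without parallel arcs, an edge being a pair of opposite arcs.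
\<close>

section \<open>Block graphs\<close>

text \<open>
  The conjunct \<^term>\<open>graph H\<close> is needed because \<^const>\<open>subgraph\<close> also admits subdigraphs that
  contain only one of two opposite arcs.
\<close>
definition two_connected :: "('a, 'b) pre_digraph \<Rightarrow> bool" where
  "two_connected H \<longleftrightarrow> graph H \<and> 3 \<le> card (verts H) \<and> connected H \<and>
     (\<forall>v \<in> verts H. connected (pre_digraph.del_vert H v))"

definition del_edge :: "('a, 'b) pre_digraph \<Rightarrow> 'a \<Rightarrow> 'a \<Rightarrow> ('a, 'b) pre_digraph" where
  "del_edge G u v = G\<lparr>arcs := {e \<in> arcs G. arc_to_ends G e \<notin> {(u, v), (v, u)}}\<rparr>"

definition bridge :: "('a, 'b) pre_digraph \<Rightarrow> 'a \<Rightarrow> 'a \<Rightarrow> bool" where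
  "bridge G u v \<longleftrightarrow> u \<rightarrow>\<^bsub>G\<^esub> v \<and> \<not> u \<rightarrow>\<^sup>*\<^bsub>del_edge G u v\<^esub> v"

definition is_block :: "('a, 'b) pre_digraph \<Rightarrow> ('a, 'b) pre_digraph \<Rightarrow> bool" where
  "is_block G H \<longleftrightarrow> pre_digraph.max_subgraph G two_connected H \<or>
     (\<exists>u v. bridge G u v \<and> H = G \<restriction> {u, v})"

definition block_graph :: "('a, 'b) pre_digraph \<Rightarrow> bool" where
  "block_graph G \<longleftrightarrow> graph G \<and> connected G \<and>
     (\<forall>H. is_block G H \<longrightarrow> complete_digraph (card (verts H)) H)"

section \<open>Zero forcing\<close>

text \<open>\<open>B\<close> is the set of black vertices before the step and \<open>B'\<close> the one after it.\<close>
definition color_change :: "('a, 'b) pre_digraph \<Rightarrow> 'a set \<Rightarrow> 'a set \<Rightarrow> bool" where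
  "color_change G B B' \<longleftrightarrow>
     (\<exists>x \<in> B. \<exists>y. {z. x \<rightarrow>\<^bsub>G\<^esub> z \<and> z \<notin> B} = {y} \<and> B' = insert y B)"

definition zero_forcing_set :: "('a, 'b) pre_digraph \<Rightarrow> 'a set \<Rightarrow> bool" where
  "zero_forcing_set G S \<longleftrightarrow> S \<subseteq> verts G \<and> (color_change G)\<^sup>*\<^sup>* S (verts G)"

definition zero_forcing_number :: "('a, 'b) pre_digraph \<Rightarrow> nat" where
  "zero_forcing_number G = Min (card ` {S. zero_forcing_set G S})"

section \<open>General position\<close>

text \<open>\<open>p\<close> is the list of arcs of a path from \<open>u\<close> to \<open>v\<close>.\<close>
definition shortest_path :: "('a, 'b) pre_digraph \<Rightarrow> 'a \<Rightarrow> 'b awalk \<Rightarrow> 'a \<Rightarrow> bool" where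
  "shortest_path G u p v \<longleftrightarrow> pre_digraph.apath G u p v \<and>
     (\<forall>q. pre_digraph.apath G u q v \<longrightarrow> length p \<le> length q)"

definition general_position_set :: "('a, 'b) pre_digraph \<Rightarrow> 'a set \<Rightarrow> bool" where
  "general_position_set G R \<longleftrightarrow> R \<subseteq> verts G \<and>
     \<not> (\<exists>x \<in> R. \<exists>y \<in> R. \<exists>z \<in> R. distinct [x, y, z] \<and>
          (\<exists>u p v. shortest_path G u p v \<and> {x, y, z} \<subseteq> set (pre_digraph.awalk_verts G u p)))"

definition gp_number :: "('a, 'b) pre_digraph \<Rightarrow> nat" where
  "gp_number G = Max (card ` {R. general_position_set G R})"

end

theory Submission
  imports Defs
begin

text \<open>
  Simplicial vertices (those whose neighbours are pairwise adjacent) are never interior to a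
  shortest path, so they form a general position set. In a block graph every cycle spans a clique.
  Hence, for the levels given by the distance from a root \<open>r\<close>, every vertex has at most one
  neighbour on the preceding level, and a vertex without neighbours on the next level is simplicial.
  In particular a vertex on the last level is simplicial, so we may choose \<open>r\<close> itself
  simplicial. The remaining simplicial vertices then form a zero forcing set: a white vertex \<open>y\<close>
  of maximal level has a neighbour on the next level, which is black and has \<open>y\<close> as its only
  white neighbour.
\<close>

section \<open>Simplicial vertices and general position\<close>

definition simplicial :: "('a, 'b) pre_digraph \<Rightarrow> 'a \<Rightarrow> bool" where
  "simplicial G v \<longleftrightarrow> v \<in> verts G \<and>
     (\<forall>x y. v \<rightarrow>\<^bsub>G\<^esub> x \<longrightarrow> v \<rightarrow>\<^bsub>G\<^esub> y \<longrightarrow> x \<noteq> y \<longrightarrow> x \<rightarrow>\<^bsub>G\<^esub> y)"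

text \<open>Each reduction step cuts a closed subwalk out of the walk. This lets the minimality in
  \<open>shortest_path\<close>, which ranges over paths only, be tested against arbitrary
  walks.\<close>

lemma (in wf_digraph) length_awalk_to_apath:
  assumes "awalk u p v"
  shows "length (awalk_to_apath p) \<le> length p"
  using assms
proof (induct rule: awalk_to_apath_induct)
  case (path p)
  then have "awalk_to_apath p = p"
    by (auto simp: awalk_to_apath.simps)
  then show ?case by simp
next
  case (decomp p q r s)
  then have "awalk_to_apath p = awalk_to_apath (q @ s)"
    by (intro step_awalk_to_apath)
  moreover from decomp have "p = q @ r @ s"
    by (auto elim: awalk_cyc_decompE)
  ultimately show ?case using decomp by auto
qed

text \<open>An interior vertex \<open>x\<close> of a path has a predecessor and a successor there.
  If \<open>x\<close> is simplicial, these two coincide or are adjacent, so \<open>x\<close> can be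
  bypassed and the path is not shortest.\<close>

lemma (in graph) simplicial_on_shortest_path:
  assumes sp: "shortest_path G u p v"
    and x: "x \<in> set (awalk_verts u p)" "simplicial G x"
  shows "x = u \<or> x = v"
proof (rule ccontr)
  assume "\<not> (x = u \<or> x = v)"
  then have ne: "x \<noteq> u" "x \<noteq> v" by auto
  from sp have ap: "apath u p v" and
    min: "\<And>q. apath u q v \<Longrightarrow> length p \<le> length q"
    by (auto simp: shortest_path_def)
  then have "awalk u p v" by (simp add: apath_def)
  from awalk_decomp[OF this x(1)] obtain q s where
    qs: "p = q @ s" "awalk u q x" "awalk x s v" by blast
  from qs(2) ne have "q \<noteq> []" by (auto simp: awalk_Nil_iff)
  then obtain q' e where q: "q = q' @ [e]" by (metis rev_exhaust)
  from qs(3) ne have "s \<noteq> []" by (auto simp: awalk_Nil_iff)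
  then obtain f s' where s: "s = f # s'" by (metis list.exhaust)
  let ?a = "tail G e" and ?b = "head G f"
  from qs(2) q have e: "e \<in> arcs G" "head G e = x" and q': "awalk u q' ?a"
    by (auto simp: awalk_simps)
  from qs(3) s have f: "f \<in> arcs G" "tail G f = x" and s': "awalk ?b s' v"
    by (auto simp: awalk_simps)
  have "x \<rightarrow>\<^bsub>G\<^esub> ?a"
    using e graph_symmetric in_arcs_imp_in_arcs_ends by metis
  moreover have "x \<rightarrow>\<^bsub>G\<^esub> ?b"
    using f in_arcs_imp_in_arcs_ends by metis
  ultimately have adj: "?a \<noteq> ?b \<Longrightarrow> ?a \<rightarrow>\<^bsub>G\<^esub> ?b"
    using x(2) by (auto simp: simplicial_def)
  \<comment> \<open>Either both arcs at \<open>x\<close> are dropped or the single arc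
    \<open>g\<close> replaces them. The result \<open>t\<close> is only known to be a walk, so it is
    reduced to a path before \<open>min\<close> is applied.\<close>
  obtain t where t: "awalk u t v" "length t < length p"
  proof (cases "?a = ?b")
    case True
    with q' s' have "awalk u (q' @ s') v" by (auto intro: awalk_appendI)
    then show ?thesis using that[of "q' @ s'"] qs(1) q s by simp
  next
    case False
    with adj obtain g where g: "g \<in> arcs G" "tail G g = ?a" "head G g = ?b" by auto
    with s' have "awalk ?a (g # s') v" by (simp add: awalk_Cons_iff)
    with q' have "awalk u (q' @ g # s') v" by (rule awalk_appendI)
    then show ?thesis using that[of "q' @ g # s'"] qs(1) q s by simp
  qed
  from t(1) have "length p \<le> length (awalk_to_apath t)"
    by (intro min apath_awalk_to_apath)
  also have "\<dots> \<le> length t"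
    using t(1) by (rule length_awalk_to_apath)
  finally show False using t(2) by simp
qed

lemma (in graph) general_position_set_simplicial:
  "general_position_set G {v. simplicial G v}"
  unfolding general_position_set_def
proof (intro conjI notI)
  show "{v. simplicial G v} \<subseteq> verts G" by (auto simp: simplicial_def)
next
  assume "\<exists>x \<in> {v. simplicial G v}. \<exists>y \<in> {v. simplicial G v}. \<exists>z \<in> {v. simplicial G v}.
    distinct [x, y, z] \<and>
    (\<exists>u p v. shortest_path G u p v \<and> {x, y, z} \<subseteq> set (awalk_verts u p))"
  then obtain x y z u p v where xyz: "simplicial G x" "simplicial G y" "simplicial G z"
      "distinct [x, y, z]" "{x, y, z} \<subseteq> set (awalk_verts u p)"
    and sp: "shortest_path G u p v"
    by (elim bexE exE conjE) simp
  then have "x \<in> {u, v}" "y \<in> {u, v}" "z \<in> {u, v}"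
    using simplicial_on_shortest_path[OF sp] by simp_all
  with xyz(4) show False by auto
qed

lemma (in graph) card_le_gp_number:
  assumes "general_position_set G R"
  shows "card R \<le> gp_number G"
proof -
  have "{R. general_position_set G R} \<subseteq> Pow (verts G)"
    by (auto simp: general_position_set_def)
  then have "finite {R. general_position_set G R}"
    by (rule finite_subset) simp
  then show ?thesis
    unfolding gp_number_def using assms by (intro Max_ge) auto
qed

section \<open>Zero forcing\<close>

lemma (in graph) zero_forcing_number_le_card:
  assumes "zero_forcing_set G S"
  shows "zero_forcing_number G \<le> card S"
proof -
  have "{S. zero_forcing_set G S} \<subseteq> Pow (verts G)"
    by (auto simp: zero_forcing_set_def)
  then have "finite {S. zero_forcing_set G S}"
    by (rule finite_subset) simp
  then show ?thesis
    unfolding zero_forcing_number_def using assms by (intro Min_le) auto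
qed

text \<open>It suffices that the process never stalls before all vertices are black: each step
  strictly shrinks the finite set of white vertices, which drives the induction.\<close>

lemma (in graph) zero_forcing_setI:
  assumes S: "S \<subseteq> verts G"
    and step: "\<And>B. S \<subseteq> B \<Longrightarrow> B \<subset> verts G \<Longrightarrow> \<exists>B'. color_change G B B'"
  shows "zero_forcing_set G S"
proof -
  have "(color_change G)\<^sup>*\<^sup>* B (verts G)" if "S \<subseteq> B" "B \<subseteq> verts G" for B
    using that
  proof (induction "card (verts G - B)" arbitrary: B rule: less_induct)
    case less
    show ?case
    proof (cases "B = verts G")
      case False
      with less.prems step[of B] obtain B' where B': "color_change G B B'" by auto
      then obtain x y where xy: "{z. x \<rightarrow>\<^bsub>G\<^esub> z \<and> z \<notin> B} = {y}" "B' = insert y B"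
        by (auto simp: color_change_def)
      then have y: "y \<in> verts G" "y \<notin> B" by (auto dest: adj_in_verts)
      then have "verts G - B' \<subset> verts G - B" using xy(2) by auto
      then have "card (verts G - B') < card (verts G - B)"
        by (intro psubset_card_mono) auto
      then have "(color_change G)\<^sup>*\<^sup>* B' (verts G)"
        using less.prems xy(2) y by (intro less.hyps) auto
      with B' show ?thesis by (rule converse_rtranclp_into_rtranclp)
    qed simp
  qed
  with S show ?thesis by (simp add: zero_forcing_set_def)
qed

section \<open>Cycles in block graphs\<close>

text \<open>Among the subgraphs with property \<open>P\<close> that contain the given one, take one
  with the most vertices and arcs together. A larger competitor would have the same counts, hence
  the same vertex and arc sets.\<close>

lemma (in fin_digraph) max_subgraph_exists:
  assumes "subgraph H\<^sub>0 G" "P H\<^sub>0"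
  obtains H where "max_subgraph P H" "subgraph H\<^sub>0 H"
proof -
  define Q where "Q H \<longleftrightarrow> subgraph H G \<and> P H \<and> subgraph H\<^sub>0 H" for H
  define f where "f H = card (verts H) + card (arcs H)" for H :: "('a, 'b) pre_digraph"
  have "Q H\<^sub>0"
    using assms by (auto simp: Q_def intro: wf_digraph.subgraph_refl)
  moreover have "\<forall>H. Q H \<longrightarrow> f H < Suc (f G)"
    unfolding Q_def f_def less_Suc_eq_le by (auto intro!: add_mono card_mono)
  ultimately obtain H where H: "Q H" and max: "\<And>H'. Q H' \<Longrightarrow> f H' \<le> f H"
    using ex_has_greatest_nat[of Q H\<^sub>0 f "Suc (f G)"] by metis
  have "H' = H" if sub: "subgraph H H'" "subgraph H' G" "P H'" for H'
  proof -
    have "subgraph H\<^sub>0 H'"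
      using H sub(1) by (auto simp: Q_def intro: subgraph_trans)
    with sub have le: "f H' \<le> f H" by (intro max) (simp add: Q_def)
    have fin: "finite (verts H')" "finite (arcs H')"
      using fin_digraph.finite_verts fin_digraph.finite_arcs fin_digraph_subgraph[OF sub(2)] by auto
    have incl: "verts H \<subseteq> verts H'" "arcs H \<subseteq> arcs H'"
      using sub(1) by auto
    with fin have "card (verts H) \<le> card (verts H')" "card (arcs H) \<le> card (arcs H')"
      by (auto intro: card_mono)
    with le have "card (verts H) = card (verts H')" "card (arcs H) = card (arcs H')"
      by (auto simp: f_def)
    then have "verts H = verts H'" "arcs H = arcs H'"
      using card_subset_eq[OF fin(1) incl(1)] card_subset_eq[OF fin(2) incl(2)] by simp_all
    \<comment> \<open>Equality of the records also needs equal incidence functions, which the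
      compatibility inside \<open>subgraph\<close> supplies.\<close>
    moreover have "tail H = tail H'" "head H = head H'"
      using sub(1) by (auto simp: subgraph_def compatible_def)
    ultimately show ?thesis by simp
  qed
  with H have "max_subgraph P H" by (auto simp: max_subgraph_def Q_def)
  with H that show ?thesis by (auto simp: Q_def)
qed

lemma dominates_induce_subgraph_iff:
  "u \<rightarrow>\<^bsub>G \<restriction> W\<^esub> v \<longleftrightarrow> u \<rightarrow>\<^bsub>G\<^esub> v \<and> u \<in> W \<and> v \<in> W"
  by (auto simp: arcs_ends_conv)

lemma del_vert_induce_subgraph:
  "pre_digraph.del_vert (G \<restriction> W) v = G \<restriction> (W - {v})"
  by (auto simp: pre_digraph.del_vert_def induce_subgraph_def)

context graph
begin

lemma graph_induce_subgraph:
  assumes "W \<subseteq> verts G"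
  shows "graph (G \<restriction> W)"
proof -
  have ind: "induced_subgraph (G \<restriction> W) G" using assms by (rule induced_induce)
  interpret H: digraph "G \<restriction> W"
    using ind by (intro digraph_subgraph induced_imp_subgraph)
  show ?thesis
    using ind sym_arcs by (intro H.graphI) (rule induced_graph_imp_symmetric)
qed

lemma connected_induce_path:
  assumes xs: "xs \<noteq> []" "set xs \<subseteq> verts G" "successively (dominates G) xs"
  shows "connected (G \<restriction> set xs)"
proof -
  let ?H = "G \<restriction> set xs"
  interpret H: graph ?H using xs(2) by (rule graph_induce_subgraph)
  \<comment> \<open>The list \<open>ys\<close> runs through the suffixes of \<open>xs\<close>, while
    the ambient graph \<open>?H\<close> stays fixed so that the induction hypothesis applies to
    it.\<close>
  have "hd ys \<rightarrow>\<^sup>*\<^bsub>?H\<^esub> x"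
    if "successively (dominates G) ys" "set ys \<subseteq> set xs" "x \<in> set ys" for ys x
    using that
  proof (induction ys)
    case (Cons y ys)
    show ?case
    proof (cases "x = y")
      case True
      then show ?thesis using Cons.prems by (auto intro: H.reachable_refl)
    next
      case False
      with Cons.prems have "x \<in> set ys" "ys \<noteq> []" by auto
      with Cons have "y \<rightarrow>\<^bsub>?H\<^esub> hd ys" "hd ys \<rightarrow>\<^sup>*\<^bsub>?H\<^esub> x"
        by (auto simp: successively_Cons dominates_induce_subgraph_iff)
      then show ?thesis by (auto intro: H.adj_reachable_trans)
    qed
  qed simp
  then have hd: "hd xs \<rightarrow>\<^sup>*\<^bsub>?H\<^esub> x" if "x \<in> set xs" for x
    using that xs(3) by blast
  have "x \<rightarrow>\<^sup>*\<^bsub>?H\<^esub> y" if "x \<in> set xs" "y \<in> set xs" for x y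
    using hd[OF that(1)] hd[OF that(2)] H.symmetric_reachable' H.reachable_trans by blast
  then show ?thesis
    unfolding connected_def using xs(1)
    by (intro strongly_connectedI) (auto intro: H.reachable_mk_symmetricI)
qed

text \<open>Deleting \<open>v\<close> from the cycle \<open>ys @ v # zs\<close> leaves the path
  \<open>zs @ ys\<close>, whose two pieces are joined by the closing edge from
  \<open>last xs\<close> to \<open>hd xs\<close>. A path induces a connected graph.\<close>

lemma two_connected_induce_cycle:
  assumes xs: "distinct xs" "3 \<le> length xs" "set xs \<subseteq> verts G"
    "successively (dominates G) xs" "last xs \<rightarrow>\<^bsub>G\<^esub> hd xs"
  shows "two_connected (G \<restriction> set xs)"
proof -
  have "connected (G \<restriction> (set xs - {v}))" if v: "v \<in> set xs" for v
  proof -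
    from v obtain ys zs where split: "xs = ys @ v # zs" by (metis split_list)
    with xs(1) have "set xs - {v} = set (zs @ ys)" by auto
    moreover have "connected (G \<restriction> set (zs @ ys))"
      using xs split
      by (intro connected_induce_path)
        (auto simp: successively_append_iff successively_Cons split: if_splits)
    ultimately show ?thesis by simp
  qed
  moreover have "connected (G \<restriction> set xs)"
    using xs by (intro connected_induce_path) auto
  ultimately show ?thesis
    using xs distinct_card[OF xs(1)] graph_induce_subgraph[OF xs(3)]
    by (simp add: two_connected_def del_vert_induce_subgraph)
qed

text \<open>The graph induced on the cycle is 2-connected, so it lies in a maximal 2-connected
  subgraph. That is a block, hence complete, and its adjacencies hold in \<open>G\<close> as
  well.\<close>

lemma block_graph_cycle_clique:
  assumes block: "block_graph G"
    and xs: "distinct xs" "3 \<le> length xs" "set xs \<subseteq> verts G"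
      "successively (dominates G) xs" "last xs \<rightarrow>\<^bsub>G\<^esub> hd xs"
    and uv: "u \<in> set xs" "v \<in> set xs" "u \<noteq> v"
  shows "u \<rightarrow>\<^bsub>G\<^esub> v"
proof -
  obtain H where H: "max_subgraph two_connected H" "subgraph (G \<restriction> set xs) H"
    using max_subgraph_exists[where P = two_connected,
        OF subgraph_induce_subgraphI[OF xs(3)] two_connected_induce_cycle[OF xs]] .
  from block H(1) have "complete_digraph (card (verts H)) H"
    by (auto simp: block_graph_def is_block_def)
  moreover have "u \<in> verts H" "v \<in> verts H"
    using H(2)[THEN subgraph_imp_subverts] uv by auto
  ultimately have "u \<rightarrow>\<^bsub>H\<^esub> v" using uv(3) by (simp add: complete_digraph_def)
  moreover have "subgraph H G" using H(1) by (rule subgraphI_max_subgraph)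
  ultimately show ?thesis using arcs_ends_mono by blast
qed

end

section \<open>Distance levels in a rooted block graph\<close>

locale rooted_block_graph = graph G for G :: "('a, 'b) pre_digraph" (structure) +
  fixes r :: 'a
  assumes block: "block_graph G" and root: "r \<in> verts G"
begin

text \<open>This is the distance from \<open>r\<close>, encoded by powers of the adjacency relation
  so that predecessors come from \<open>relpow_Suc_E\<close>. Outside \<open>verts G\<close> the
  value is unspecified.\<close>

definition level :: "'a \<Rightarrow> nat" where
  "level x = (LEAST n. (r, x) \<in> arcs_ends G ^^ n)"

lemma reachable_from_root:
  assumes "x \<in> verts G"
  shows "r \<rightarrow>\<^sup>* x"
proof -
  from block have "strongly_connected (mk_symmetric G)"
    by (simp add: block_graph_def connected_def)
  with assms root have "r \<rightarrow>\<^sup>*\<^bsub>mk_symmetric G\<^esub> x" by (auto simp: strongly_connected_def)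
  then show ?thesis by (simp add: reachable_mk_symmetric_eq[OF sym_arcs])
qed

lemma level_le: "(r, x) \<in> arcs_ends G ^^ n \<Longrightarrow> level x \<le> n"
  unfolding level_def by (rule Least_le)

lemma relpow_level:
  assumes "x \<in> verts G"
  shows "(r, x) \<in> arcs_ends G ^^ level x"
proof -
  have "(r, x) \<in> (arcs_ends G)\<^sup>*"
    using reachable_from_root[OF assms] unfolding reachable_def by (rule rtrancl_on_rtranclI)
  then obtain n where "(r, x) \<in> arcs_ends G ^^ n" using rtrancl_power by blast
  then show ?thesis unfolding level_def by (rule LeastI)
qed

lemma level_eq_0_iff: "x \<in> verts G \<Longrightarrow> level x = 0 \<longleftrightarrow> x = r"
  using relpow_level[of x] level_le[of r 0] by auto

lemma level_le_Suc:
  assumes "x \<rightarrow>\<^bsub>G\<^esub> y"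
  shows "level y \<le> Suc (level x)"
proof (rule level_le)
  have "(r, x) \<in> arcs_ends G ^^ level x"
    using assms by (intro relpow_level) (auto dest: adj_in_verts)
  with assms show "(r, y) \<in> arcs_ends G ^^ Suc (level x)" by (rule relpow_Suc_I[rotated])
qed

lemma parent_exists:
  assumes "x \<in> verts G" "level x = Suc k"
  obtains p where "p \<rightarrow>\<^bsub>G\<^esub> x" "level p = k"
proof -
  have "(r, x) \<in> arcs_ends G ^^ Suc k" using relpow_level[OF assms(1)] assms(2) by simp
  then obtain p where p: "(r, p) \<in> arcs_ends G ^^ k" "p \<rightarrow>\<^bsub>G\<^esub> x" by (rule relpow_Suc_E)
  then have "level p \<le> k" by (intro level_le)
  with level_le_Suc[OF p(2)] assms(2) have "level p = k" by simp
  with p(2) that show ?thesis by blast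
qed

text \<open>Step from both vertices to neighbours one level closer to the root, and repeat until
  these coincide, at the latest in \<open>r\<close>. The last conjunct separates a common neighbour
  from a longer detour, which must go at least two levels down; \<open>parent_common\<close>
  excludes the latter.\<close>

lemma path_below:
  assumes "v \<in> verts G" "v' \<in> verts G" "v \<noteq> v'" "level v = k" "level v' = k"
  shows "\<exists>xs. xs \<noteq> [] \<and> distinct xs \<and> successively (dominates G) (v # xs @ [v']) \<and>
    (\<forall>u \<in> set xs. u \<in> verts G \<and> level u < k) \<and> (length xs = 1 \<or> (\<exists>u \<in> set xs. Suc (level u) < k))"
  using assms
proof (induction k arbitrary: v v')
  case 0
  then show ?case by (simp add: level_eq_0_iff)
next
  case (Suc k)
  obtain p where p: "p \<rightarrow>\<^bsub>G\<^esub> v" "level p = k" using parent_exists Suc.prems by metis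
  obtain p' where p': "p' \<rightarrow>\<^bsub>G\<^esub> v'" "level p' = k" using parent_exists Suc.prems by metis
  from p p' have verts: "p \<in> verts G" "p' \<in> verts G" by (auto dest: adj_in_verts)
  from p(1) have vp: "v \<rightarrow>\<^bsub>G\<^esub> p" by (rule graph_symmetric)
  show ?case
  proof (cases "p = p'")
    case True
    then show ?thesis using p p' vp verts by (intro exI[of _ "[p]"]) auto
  next
    case False
    from Suc.IH[OF verts this p(2) p'(2)] obtain xs where
      xs: "xs \<noteq> []" "distinct xs" "successively (dominates G) (p # xs @ [p'])"
        "\<forall>u \<in> set xs. u \<in> verts G \<and> level u < k" by blast
    let ?ys = "p # xs @ [p']"
    have "distinct ?ys" using xs(2,4) False p(2) p'(2) by auto
    moreover have "successively (dominates G) (v # ?ys @ [v'])"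
      using xs(3) vp p'(1) by (auto simp: successively_Cons successively_append_iff hd_append)
    moreover have "\<forall>u \<in> set ?ys. u \<in> verts G \<and> level u < Suc k"
      using xs(4) verts p(2) p'(2) by auto
    \<comment> \<open>The inner path \<open>xs\<close> is nonempty and lies below level
      \<open>k\<close>, hence two levels below \<open>v\<close>.\<close>
    moreover have "\<exists>u \<in> set ?ys. Suc (level u) < Suc k"
      using xs(1,4) by (auto simp: neq_Nil_conv)
    ultimately show ?thesis by (intro exI[of _ ?ys]) auto
  qed
qed

text \<open>Two parents of \<open>w\<close>, the path below them and \<open>w\<close> itself form a
  cycle, hence a clique. Then \<open>w\<close> is adjacent to an interior vertex of that path, at
  least two levels away, which is impossible.\<close>

lemma parent_unique:
  assumes "v \<rightarrow>\<^bsub>G\<^esub> w" "v' \<rightarrow>\<^bsub>G\<^esub> w" "level v = k" "level v' = k" "level w = Suc k"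
  shows "v = v'"
proof (rule ccontr)
  assume ne: "v \<noteq> v'"
  from assms have verts: "v \<in> verts G" "v' \<in> verts G" "w \<in> verts G"
    by (auto dest: adj_in_verts)
  from path_below[OF verts(1,2) ne assms(3,4)] obtain xs where
    xs: "xs \<noteq> []" "distinct xs" "successively (dominates G) (v # xs @ [v'])"
      "\<forall>u \<in> set xs. u \<in> verts G \<and> level u < k" by blast
  from xs(1) obtain u where u: "u \<in> set xs" by (cases xs) auto
  have "w \<rightarrow>\<^bsub>G\<^esub> u"
  proof (rule block_graph_cycle_clique[OF block])
    show "distinct (w # v # xs @ [v'])"
      using xs(2,4) assms(3-5) ne by auto
    show "successively (dominates G) (w # v # xs @ [v'])"
      using xs(3) graph_symmetric[OF assms(1)] by simp
    show "w \<noteq> u" using u xs(4) assms(5) by auto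
  qed (use u xs(4) verts assms(2) in auto)
  then have "level w \<le> Suc (level u)" by (rule level_le_Suc[OF graph_symmetric])
  with u xs(4) assms(5) show False by auto
qed

text \<open>The edge between \<open>v\<close> and \<open>x\<close> closes the path below them to a
  cycle, hence a clique. So \<open>v\<close> is adjacent to every interior vertex, none of which can
  then be two levels below it. The path thus has one interior vertex \<open>q\<close>, a common
  neighbour, and \<open>q\<close> is \<open>p\<close> because parents are unique.\<close>

lemma parent_common:
  assumes vx: "v \<rightarrow>\<^bsub>G\<^esub> x" "level x = level v" and p: "p \<rightarrow>\<^bsub>G\<^esub> v" "level v = Suc (level p)"
  shows "p \<rightarrow>\<^bsub>G\<^esub> x"
proof -
  from vx have verts: "v \<in> verts G" "x \<in> verts G" and ne: "v \<noteq> x"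
    by (auto dest: adj_in_verts adj_not_same)
  from path_below[OF verts ne refl vx(2)] obtain xs where
    xs: "xs \<noteq> []" "distinct xs" "successively (dominates G) (v # xs @ [x])"
      "\<forall>u \<in> set xs. u \<in> verts G \<and> level u < level v"
      "length xs = 1 \<or> (\<exists>u \<in> set xs. Suc (level u) < level v)" by blast
  have len: "length xs \<ge> 1" using xs(1) by (cases xs) auto
  have "\<not> Suc (level u) < level v" if u: "u \<in> set xs" for u
  proof -
    have "v \<rightarrow>\<^bsub>G\<^esub> u"
    proof (rule block_graph_cycle_clique[OF block])
      show "distinct (v # xs @ [x])"
        using xs(2,4) vx(2) ne by auto
      show "v \<noteq> u" using u xs(4) by auto
      show "last (v # xs @ [x]) \<rightarrow>\<^bsub>G\<^esub> hd (v # xs @ [x])" using graph_symmetric[OF vx(1)] by simp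
    qed (use u xs(3,4) verts len in auto)
    then have "level v \<le> Suc (level u)" by (rule level_le_Suc[OF graph_symmetric])
    then show ?thesis by simp
  qed
  with xs(5) obtain q where q: "xs = [q]" by (auto simp: length_Suc_conv)
  with xs(3) have "v \<rightarrow>\<^bsub>G\<^esub> q" "q \<rightarrow>\<^bsub>G\<^esub> x" by auto
  moreover from this(1) have "q \<rightarrow>\<^bsub>G\<^esub> v" by (rule graph_symmetric)
  moreover have "level q = level p"
    using level_le_Suc[OF \<open>q \<rightarrow>\<^bsub>G\<^esub> v\<close>] xs(4) q p(2) by auto
  ultimately show ?thesis using parent_unique p by metis
qed

text \<open>Without a child, \<open>v\<close> has as neighbours only its parent \<open>p\<close> and
  vertices of its own level, which are adjacent to \<open>p\<close> too. Two of the latter lie with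
  \<open>v\<close> and \<open>p\<close> on a 4-cycle, which is a clique.\<close>

lemma childless_simplicial:
  assumes v: "v \<in> verts G" and childless: "\<And>w. v \<rightarrow>\<^bsub>G\<^esub> w \<Longrightarrow> level w \<noteq> Suc (level v)"
  shows "simplicial G v"
proof (cases "level v")
  case 0
  \<comment> \<open>Here \<open>v\<close> is the root. A neighbour would have level 0 or 1, so it
    would be the root itself or a child; hence there are no neighbours and the claim is
    vacuous.\<close>
  have False if "v \<rightarrow>\<^bsub>G\<^esub> w" for w
  proof -
    have "level w = 0" using level_le_Suc[OF that] childless[OF that] 0 by auto
    then have "w = v" using 0 v that by (auto simp: level_eq_0_iff dest: adj_in_verts)
    then show False using that by (auto dest: adj_not_same)
  qed
  then show ?thesis using v by (auto simp: simplicial_def)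
next
  case (Suc m)
  then obtain p where p: "p \<rightarrow>\<^bsub>G\<^esub> v" "level p = m" using parent_exists v by metis
  have nbr: "w = p \<or> level w = level v \<and> p \<rightarrow>\<^bsub>G\<^esub> w" if "v \<rightarrow>\<^bsub>G\<^esub> w" for w
  proof -
    have wv: "w \<rightarrow>\<^bsub>G\<^esub> v" using that by (rule graph_symmetric)
    have "level w = m \<or> level w = level v"
      using level_le_Suc[OF wv] level_le_Suc[OF that] childless[OF that] Suc by auto
    then show ?thesis
      using parent_unique[OF wv p(1)] parent_common[OF that _ p(1)] p(2) Suc by auto
  qed
  have "x \<rightarrow>\<^bsub>G\<^esub> y" if xy: "v \<rightarrow>\<^bsub>G\<^esub> x" "v \<rightarrow>\<^bsub>G\<^esub> y" "x \<noteq> y" for x y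
  proof -
    consider "x = p" | "y = p" | "level x = level v" "p \<rightarrow>\<^bsub>G\<^esub> x" "level y = level v" "p \<rightarrow>\<^bsub>G\<^esub> y"
      using nbr xy by blast
    then show ?thesis
    proof cases
      case 1
      then show ?thesis using nbr[OF xy(2)] xy(3) by auto
    next
      case 2
      then show ?thesis using nbr[OF xy(1)] xy(3) graph_symmetric[of p x] by auto
    next
      case 3
      show ?thesis
      proof (rule block_graph_cycle_clique[OF block])
        show "distinct [x, v, y, p]"
          using 3 xy p(2) Suc by (auto dest: adj_not_same)
        show "successively (dominates G) [x, v, y, p]"
          using 3 xy graph_symmetric[OF xy(1)] graph_symmetric[OF 3(4)] by auto
      qed (use 3 xy p in \<open>auto dest: adj_in_verts\<close>)
    qed
  qed
  then show ?thesis using v by (auto simp: simplicial_def)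
qed

lemma simplicial_exists: "\<exists>v. simplicial G v"
proof -
  have "Max (level ` verts G) \<in> level ` verts G" using root by (intro Max_in) auto
  then obtain v where v: "v \<in> verts G" "level v = Max (level ` verts G)"
    by auto
  have "level w \<le> level v" if "w \<in> verts G" for w
    unfolding v(2) using that by (intro Max_ge) auto
  then have "level w \<noteq> Suc (level v)" if "v \<rightarrow>\<^bsub>G\<^esub> w" for w
    using adj_in_verts(2)[OF that] by fastforce
  with v(1) show ?thesis using childless_simplicial by blast
qed

lemma zero_forcing_set_simplicial:
  assumes "2 \<le> card (verts G)"
  shows "zero_forcing_set G ({v. simplicial G v} - {r})"
proof (rule zero_forcing_setI)
  fix B assume B: "{v. simplicial G v} - {r} \<subseteq> B" "B \<subset> verts G"
  then have "Max (level ` (verts G - B)) \<in> level ` (verts G - B)" by (intro Max_in) auto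
  then obtain y where y: "y \<in> verts G" "y \<notin> B" "level y = Max (level ` (verts G - B))"
    by auto
  have max: "level z \<le> level y" if "z \<in> verts G" "z \<notin> B" for z
    unfolding y(3) using that by (intro Max_ge) auto
  \<comment> \<open>A white vertex other than \<open>r\<close> is not simplicial and so has a child.
    The root may be white even if it is simplicial, but any neighbour of it is a child, and one
    exists since \<open>G\<close> is connected with a second vertex.\<close>
  obtain w where w: "y \<rightarrow>\<^bsub>G\<^esub> w" "level w = Suc (level y)"
  proof (cases "y = r")
    case True
    have "verts G \<noteq> {r}" using assms by auto
    then obtain x where x: "x \<in> verts G" "x \<noteq> r" using root by auto
    from reachable_from_root[OF x(1)] x(2) obtain w where w: "r \<rightarrow>\<^bsub>G\<^esub> w"
      by (cases rule: converse_reachable_cases) auto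
    have "w \<noteq> r" "w \<in> verts G" using w by (auto dest: adj_in_verts adj_not_same)
    moreover have "level r = 0" using root by (simp add: level_eq_0_iff)
    ultimately have "level w = Suc (level r)"
      using level_le_Suc[OF w] level_eq_0_iff[of w] by auto
    with w True that show ?thesis by blast
  next
    case False
    with y B have "\<not> simplicial G y" by auto
    with y(1) childless_simplicial that show ?thesis by blast
  qed
  have wy: "w \<rightarrow>\<^bsub>G\<^esub> y" using w(1) by (rule graph_symmetric)
  have "w \<in> B" using max[of w] w by (auto dest: adj_in_verts)
  \<comment> \<open>A white neighbour \<open>z\<close> of \<open>w\<close> is at most as high as
    \<open>y\<close> by maximality, and at least as high because it is adjacent to \<open>w\<close>.
    So \<open>z\<close> and \<open>y\<close> are both parents of \<open>w\<close>.\<close>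
  moreover have "z = y" if z: "w \<rightarrow>\<^bsub>G\<^esub> z" "z \<notin> B" for z
  proof -
    have zw: "z \<rightarrow>\<^bsub>G\<^esub> w" using z(1) by (rule graph_symmetric)
    then have "level z = level y"
      using max[of z] z(2) level_le_Suc[OF zw] w(2) by (auto dest: adj_in_verts)
    with zw w show ?thesis using parent_unique by metis
  qed
  then have "{z. w \<rightarrow>\<^bsub>G\<^esub> z \<and> z \<notin> B} = {y}" using wy y(2) by blast
  ultimately show "\<exists>B'. color_change G B B'" unfolding color_change_def by blast
qed (auto simp: simplicial_def)

end

theorem theorem3p1:
  fixes G :: "('a, 'b) pre_digraph"
  assumes "block_graph G"
    and "2 \<le> card (verts G)"
  shows "gp_number G \<ge> zero_forcing_number G + 1"
proof -
  interpret graph G using assms(1) by (simp add: block_graph_def)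
  let ?S = "{v. simplicial G v}"
  obtain r\<^sub>0 where "r\<^sub>0 \<in> verts G" using assms(2) by (cases "verts G = {}") auto
  then interpret R\<^sub>0: rooted_block_graph G r\<^sub>0 using assms(1) by unfold_locales
  \<comment> \<open>Levels from the arbitrary root \<open>r\<^sub>0\<close> serve to find a
    simplicial vertex. Taking that vertex as the new root makes \<open>?S - {r}\<close> exactly one
    element smaller than \<open>?S\<close>, which gives the summand 1.\<close>
  obtain r where r: "simplicial G r" using R\<^sub>0.simplicial_exists by blast
  then interpret R: rooted_block_graph G r
    using assms(1) by unfold_locales (simp_all add: simplicial_def)
  have fin: "finite ?S" by (rule finite_subset[of _ "verts G"]) (auto simp: simplicial_def)
  have "zero_forcing_number G + 1 \<le> card (?S - {r}) + 1"
    using zero_forcing_number_le_card[OF R.zero_forcing_set_simplicial[OF assms(2)]] by simp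
  also have "\<dots> = card ?S"
    using card_Suc_Diff1[OF fin, of r] r by simp
  also have "\<dots> \<le> gp_number G"
    by (rule card_le_gp_number[OF general_position_set_simplicial])
  finally show ?thesis .
qed

end
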